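(* Let $\beta\ge0$ be real. Among the flat Lie algebras on $\mathfrak g_{3,5}$ given in the list of the context: (i) none is associative; (ii) the Novikov ones are exactly $\mathfrak h_{0,1}^{\lambda=0},\mathfrak h_{0,2}$; (iii) none is bi-symmetric; (iv) the complete ones are exactly $\mathfrak h_{0,1}^{\lambda=0},\mathfrak h_{0,3}^{\beta=0}$.
   Context: A flat Lie algebra is a real Lie algebra $\mathfrak g$ with a bilinear product $X\cdot Y=\nabla_XY$ such that $X\cdot Y-Y\cdot X=[X,Y]$ and $[X,Y]\cdot Z=X\cdot(Y\cdot Z)-Y\cdot(X\cdot Z)$. Put $R_X(Y)=Y\cdot X$ and $(X,Y,Z)=(X\cdot Y)\cdot Z-X\cdot(Y\cdot Z)$. It is associative if $(X,Y,Z)=0$ for all $X,Y,Z$; Novikov if $R_XR_Y=R_YR_X$ for all $X,Y$; bi-symmetric if $(X,Y,Z)=(X,Z,Y)$ for all $X,Y,Z$; complete if every $R_X$ is nilpotent. A superscript restricts the indicated parameter (possibly $\beta$) to the indicated value; parameters not mentioned take all admissible values. List on the Lie algebra $\mathfrak g_{3,5}$ with basis $e_1,e_2,e_3$ and nonzero brackets $[e_1,e_3]=\beta e_1-e_2$, $[e_2,e_3]=e_1+\beta e_2$ (only nonzero products $e_ie_j=e_i\cdot e_j$ given): $\mathfrak h_{0,1}$: $e_3e_1=-\beta e_1+e_2,\ e_3e_2=-e_1-\beta e_2,\ e_3e_3=\lambda e_3$; $\lambda\in\mathbb R$. $\mathfrak h_{0,2}$: $e_1e_3=\lambda e_1,\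 e_2e_3=\lambda e_2,\ e_3e_1=(\lambda-\beta)e_1+e_2,\ e_3e_2=-e_1+(\lambda-\beta)e_2,\ e_3e_3=\lambda e_3$; $\lambda\in\mathbb R\setminus\{0\}$. $\mathfrak h_{0,3}$: $e_1e_1=\varepsilon e_3,\ e_2e_2=\varepsilon e_3,\ e_3e_1=-\beta e_1+e_2,\ e_3e_2=-e_1-\beta e_2,\ e_3e_3=-2\beta e_3$; $\varepsilon=\pm1$. *)

theory Defs
  imports "HOL-Analysis.Analysis"
begin

section \<open>Flat Lie algebras\<close>

definition lie_bracket :: "('a::real_vector \<Rightarrow> 'a \<Rightarrow> 'a) \<Rightarrow> bool" where
  "lie_bracket br \<longleftrightarrow>
     bilinear br \<and>
     (\<forall>X. br X X = 0) \<and>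
     (\<forall>X Y Z. br X (br Y Z) + br Y (br Z X) + br Z (br X Y) = 0)"

definition flat_lie_algebra ::
    "('a::real_vector \<Rightarrow> 'a \<Rightarrow> 'a) \<Rightarrow> ('a \<Rightarrow> 'a \<Rightarrow> 'a) \<Rightarrow> bool" where
  "flat_lie_algebra br p \<longleftrightarrow>
     lie_bracket br \<and>
     bilinear p \<and>
     (\<forall>X Y. p X Y - p Y X = br X Y) \<and>
     (\<forall>X Y Z. p (br X Y) Z = p X (p Y Z) - p Y (p X Z))"

definition rmult :: "('a \<Rightarrow> 'a \<Rightarrow> 'a) \<Rightarrow> 'a \<Rightarrow> 'a \<Rightarrow> 'a" where
  "rmult p X Y = p Y X"

definition associator :: "('a::real_vector \<Rightarrow> 'a \<Rightarrow> 'a) \<Rightarrow> 'a \<Rightarrow> 'a \<Rightarrow> 'a \<Rightarrow> 'a" where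
  "associator p X Y Z = p (p X Y) Z - p X (p Y Z)"

definition nilpotent_map :: "('a::zero \<Rightarrow> 'a) \<Rightarrow> bool" where
  "nilpotent_map f \<longleftrightarrow> (\<exists>n. f ^^ n = (\<lambda>_. 0))"

definition associative_product :: "('a::real_vector \<Rightarrow> 'a \<Rightarrow> 'a) \<Rightarrow> bool" where
  "associative_product p \<longleftrightarrow> (\<forall>X Y Z. associator p X Y Z = 0)"

definition novikov_product :: "('a::real_vector \<Rightarrow> 'a \<Rightarrow> 'a) \<Rightarrow> bool" where
  "novikov_product p \<longleftrightarrow> (\<forall>X Y. rmult p X \<circ> rmult p Y = rmult p Y \<circ> rmult p X)"

definition bisymmetric_product :: "('a::real_vector \<Rightarrow> 'a \<Rightarrow> 'a) \<Rightarrow> bool" where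
  "bisymmetric_product p \<longleftrightarrow> (\<forall>X Y Z. associator p X Y Z = associator p X Z Y)"

definition complete_product :: "('a::real_vector \<Rightarrow> 'a \<Rightarrow> 'a) \<Rightarrow> bool" where
  "complete_product p \<longleftrightarrow> (\<forall>X. nilpotent_map (rmult p X))"

section \<open>The Lie algebra \<open>g\<^sub>3\<^sub>,\<^sub>5\<close> and the listed flat products\<close>

text \<open>The underlying vector space is \<open>real ^ 3\<close>. Its index type \<open>3\<close> has the elements
  \<open>1\<close>, \<open>2\<close> and \<open>3\<close> (the last being equal to \<open>0\<close>).\<close>

abbreviation e :: "3 \<Rightarrow> real ^ 3" where
  "e i \<equiv> axis i 1"

text \<open>The bilinear map taking \<open>(e i, e j)\<close> to \<open>c (i, j)\<close>.\<close>

definition bilinear_ext :: "(3 \<times> 3 \<Rightarrow> real ^ 3) \<Rightarrow> real ^ 3 \<Rightarrow> real ^ 3 \<Rightarrow> real ^ 3" where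
  "bilinear_ext c X Y = (\<Sum>i\<in>UNIV. \<Sum>j\<in>UNIV. (X $ i * Y $ j) *\<^sub>R c (i, j))"

definition g35_bracket :: "real \<Rightarrow> real ^ 3 \<Rightarrow> real ^ 3 \<Rightarrow> real ^ 3" where
  "g35_bracket \<beta> = bilinear_ext ((\<lambda>_. 0)
     ((1, 3) := \<beta> *\<^sub>R e 1 - e 2,
      (2, 3) := e 1 + \<beta> *\<^sub>R e 2,
      (3, 1) := - (\<beta> *\<^sub>R e 1 - e 2),
      (3, 2) := - (e 1 + \<beta> *\<^sub>R e 2)))"

definition h01 :: "real \<Rightarrow> real \<Rightarrow> real ^ 3 \<Rightarrow> real ^ 3 \<Rightarrow> real ^ 3" where
  "h01 \<beta> l = bilinear_ext ((\<lambda>_. 0)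
     ((3, 1) := - \<beta> *\<^sub>R e 1 + e 2,
      (3, 2) := - e 1 - \<beta> *\<^sub>R e 2,
      (3, 3) := l *\<^sub>R e 3))"

definition h02 :: "real \<Rightarrow> real \<Rightarrow> real ^ 3 \<Rightarrow> real ^ 3 \<Rightarrow> real ^ 3" where
  "h02 \<beta> l = bilinear_ext ((\<lambda>_. 0)
     ((1, 3) := l *\<^sub>R e 1,
      (2, 3) := l *\<^sub>R e 2,
      (3, 1) := (l - \<beta>) *\<^sub>R e 1 + e 2,
      (3, 2) := - e 1 + (l - \<beta>) *\<^sub>R e 2,
      (3, 3) := l *\<^sub>R e 3))"

definition h03 :: "real \<Rightarrow> real \<Rightarrow> real ^ 3 \<Rightarrow> real ^ 3 \<Rightarrow> real ^ 3" where
  "h03 \<beta> \<epsilon> = bilinear_ext ((\<lambda>_. 0)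
     ((1, 1) := \<epsilon> *\<^sub>R e 3,
      (2, 2) := \<epsilon> *\<^sub>R e 3,
      (3, 1) := - \<beta> *\<^sub>R e 1 + e 2,
      (3, 2) := - e 1 - \<beta> *\<^sub>R e 2,
      (3, 3) := (- 2 * \<beta>) *\<^sub>R e 3))"

definition g35_list :: "real \<Rightarrow> (real ^ 3 \<Rightarrow> real ^ 3 \<Rightarrow> real ^ 3) set" where
  "g35_list \<beta> =
     {h01 \<beta> l | l. True} \<union> {h02 \<beta> l | l. l \<noteq> 0} \<union> {h03 \<beta> \<epsilon> | \<epsilon>. \<epsilon> \<in> {1, - 1}}"

lemma bilinear_ext_basis [simp]: "bilinear_ext c (e i) (e j) = c (i, j)"
proof -
  have "bilinear_ext c (e i) (e j) =
      (\<Sum>k\<in>UNIV. \<Sum>m\<in>UNIV. if m = j then (if k = i then c (k, m) else 0) else 0)"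
    unfolding bilinear_ext_def by (intro sum.cong refl) (auto simp: axis_def)
  then show ?thesis by simp
qed

lemma bilinear_bilinear_ext: "bilinear (bilinear_ext c)"
  unfolding bilinear_def bilinear_ext_def
  by (auto intro!: linearI simp: algebra_simps sum.distrib scaleR_sum_right)

lemmas product_table_simps =
  bilinear_ext_def vec_eq_iff forall_3 sum_3 axis_def

lemma lie_bracket_g35: "lie_bracket (g35_bracket \<beta>)"
  unfolding lie_bracket_def
  by (auto simp: g35_bracket_def bilinear_bilinear_ext)
     (simp_all add: product_table_simps algebra_simps)

lemma flat_h01: "flat_lie_algebra (g35_bracket \<beta>) (h01 \<beta> l)"
  unfolding flat_lie_algebra_def
  by (auto simp: lie_bracket_g35 h01_def bilinear_bilinear_ext)
     (simp_all add: g35_bracket_def product_table_simps algebra_simps)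

lemma flat_h02: "flat_lie_algebra (g35_bracket \<beta>) (h02 \<beta> l)"
  unfolding flat_lie_algebra_def
  by (auto simp: lie_bracket_g35 h02_def bilinear_bilinear_ext)
     (simp_all add: g35_bracket_def product_table_simps algebra_simps)

lemma flat_h03: "flat_lie_algebra (g35_bracket \<beta>) (h03 \<beta> \<epsilon>)"
  unfolding flat_lie_algebra_def
  by (auto simp: lie_bracket_g35 h03_def bilinear_bilinear_ext)
     (simp_all add: g35_bracket_def product_table_simps algebra_simps)

lemma g35_list_flat: "p \<in> g35_list \<beta> \<Longrightarrow> flat_lie_algebra (g35_bracket \<beta>) p"
  unfolding g35_list_def using flat_h01 flat_h02 flat_h03 by blast

text \<open>Distinct labels name distinct products, so that a set of products determines
  which members of the list it consists of.\<close>

lemma h01_inject: "h01 \<beta> l = h01 \<beta> l' \<longleftrightarrow> l = l'"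
proof
  assume "h01 \<beta> l = h01 \<beta> l'"
  then have "h01 \<beta> l (e 3) (e 3) $ 3 = h01 \<beta> l' (e 3) (e 3) $ 3" by simp
  then show "l = l'" by (simp add: h01_def)
qed simp

lemma h02_inject: "h02 \<beta> l = h02 \<beta> l' \<longleftrightarrow> l = l'"
proof
  assume "h02 \<beta> l = h02 \<beta> l'"
  then have "h02 \<beta> l (e 3) (e 3) $ 3 = h02 \<beta> l' (e 3) (e 3) $ 3" by simp
  then show "l = l'" by (simp add: h02_def)
qed simp

lemma h03_inject: "h03 \<beta> \<epsilon> = h03 \<beta> \<epsilon>' \<longleftrightarrow> \<epsilon> = \<epsilon>'"
proof
  assume "h03 \<beta> \<epsilon> = h03 \<beta> \<epsilon>'"
  then have "h03 \<beta> \<epsilon> (e 1) (e 1) $ 3 = h03 \<beta> \<epsilon>' (e 1) (e 1) $ 3" by simp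
  then show "\<epsilon> = \<epsilon>'" by (simp add: h03_def)
qed simp

lemma h01_neq_h02: "l' \<noteq> 0 \<Longrightarrow> h01 \<beta> l \<noteq> h02 \<beta> l'"
proof
  assume "l' \<noteq> 0" "h01 \<beta> l = h02 \<beta> l'"
  then have "h01 \<beta> l (e 1) (e 3) $ 1 = h02 \<beta> l' (e 1) (e 3) $ 1" by simp
  with \<open>l' \<noteq> 0\<close> show False by (simp add: h01_def h02_def)
qed

lemma h01_neq_h03: "\<epsilon> \<noteq> 0 \<Longrightarrow> h01 \<beta> l \<noteq> h03 \<beta> \<epsilon>"
proof
  assume "\<epsilon> \<noteq> 0" "h01 \<beta> l = h03 \<beta> \<epsilon>"
  then have "h01 \<beta> l (e 1) (e 1) $ 3 = h03 \<beta> \<epsilon> (e 1) (e 1) $ 3" by simp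
  with \<open>\<epsilon> \<noteq> 0\<close> show False by (simp add: h01_def h03_def)
qed

lemma h02_neq_h03: "\<epsilon> \<noteq> 0 \<Longrightarrow> h02 \<beta> l \<noteq> h03 \<beta> \<epsilon>"
proof
  assume "\<epsilon> \<noteq> 0" "h02 \<beta> l = h03 \<beta> \<epsilon>"
  then have "h02 \<beta> l (e 1) (e 1) $ 3 = h03 \<beta> \<epsilon> (e 1) (e 1) $ 3" by simp
  with \<open>\<epsilon> \<noteq> 0\<close> show False by (simp add: h02_def h03_def)
qed

end

theory Submission
  imports Defs
begin

text \<open>
  Write \<open>v = e 3\<close> and let \<open>M\<close> be left multiplication by \<open>v\<close> on the plane spanned by \<open>e 1\<close> and
  \<open>e 2\<close>. For every product in the list, \<open>v \<cdot> v = \<mu> v\<close> with \<open>\<mu>\<close> real, and the matrix of \<open>M\<close> is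
  a real scalar plus a rotation by a right angle, so \<open>M\<close> has no real eigenvalue. Hence
  \<open>(v, v, e 1) = M (\<mu> - M) (e 1)\<close> is nonzero, while \<open>(v, e 1, v) = 0\<close>; this excludes both
  associativity and bi-symmetry. Since \<open>v\<close> is an eigenvector of \<open>R\<^sub>v\<close> with eigenvalue \<open>\<mu>\<close>,
  completeness forces \<open>\<mu> = 0\<close>, and then all \<open>R\<^sub>X\<close> have vanishing cube.
\<close>

lemma h01_nth:
  "h01 \<beta> l X Y $ 1 = X $ 3 * (- \<beta> * Y $ 1 - Y $ 2)"
  "h01 \<beta> l X Y $ 2 = X $ 3 * (Y $ 1 - \<beta> * Y $ 2)"
  "h01 \<beta> l X Y $ 3 = l * X $ 3 * Y $ 3"
  by (simp_all add: h01_def product_table_simps algebra_simps)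

lemma h02_nth:
  "h02 \<beta> l X Y $ 1 = l * X $ 1 * Y $ 3 + X $ 3 * ((l - \<beta>) * Y $ 1 - Y $ 2)"
  "h02 \<beta> l X Y $ 2 = l * X $ 2 * Y $ 3 + X $ 3 * (Y $ 1 + (l - \<beta>) * Y $ 2)"
  "h02 \<beta> l X Y $ 3 = l * X $ 3 * Y $ 3"
  by (simp_all add: h02_def product_table_simps algebra_simps)

lemma h03_nth:
  "h03 \<beta> \<epsilon> X Y $ 1 = X $ 3 * (- \<beta> * Y $ 1 - Y $ 2)"
  "h03 \<beta> \<epsilon> X Y $ 2 = X $ 3 * (Y $ 1 - \<beta> * Y $ 2)"
  "h03 \<beta> \<epsilon> X Y $ 3 = \<epsilon> * (X $ 1 * Y $ 1 + X $ 2 * Y $ 2) - 2 * \<beta> * X $ 3 * Y $ 3"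
  by (simp_all add: h03_def product_table_simps algebra_simps)

lemmas g35_nth = h01_nth h02_nth h03_nth

lemma g35_list_cases [consumes 1, case_names h01 h02 h03]:
  assumes "p \<in> g35_list \<beta>"
  obtains l where "p = h01 \<beta> l"
    | l where "l \<noteq> 0" "p = h02 \<beta> l"
    | \<epsilon> where "\<epsilon> = 1 \<or> \<epsilon> = - 1" "p = h03 \<beta> \<epsilon>"
  using assms unfolding g35_list_def by blast

text \<open>Right multiplication by \<open>e 3\<close> acts on the plane as a real scalar
  (\<open>l\<close> for \<open>h02\<close>, zero otherwise), so it commutes with
  \<open>M\<close>.\<close>

lemma g35_list_associator_e3_e1_e3:
  assumes "p \<in> g35_list \<beta>"
  shows "associator p (e 3) (e 1) (e 3) = 0"
  using assms
  by (cases rule: g35_list_cases)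
     (simp_all add: associator_def vec_eq_iff forall_3 g35_nth axis_def algebra_simps)

text \<open>Reading \<open>e 1\<close>, \<open>e 2\<close> as 1 and i, \<open>M\<close> is
  multiplication by a + i, and the two coordinates are the real and imaginary parts of (\<mu> - (a +
  i))(a + i).\<close>

lemma g35_list_associator_e3_e3_e1_nth:
  assumes "p \<in> g35_list \<beta>"
  obtains \<mu> a where
    "associator p (e 3) (e 3) (e 1) $ 1 = \<mu> * a - a\<^sup>2 + 1"
    "associator p (e 3) (e 3) (e 1) $ 2 = \<mu> - 2 * a"
  using assms
proof (cases rule: g35_list_cases)
  case (h01 l)
  then show thesis
    by (intro that[of "l" "- \<beta>"])
       (simp_all add: associator_def g35_nth axis_def power2_eq_square algebra_simps)
next
  case (h02 l)
  then show thesis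
    by (intro that[of "l" "l - \<beta>"])
       (simp_all add: associator_def g35_nth axis_def power2_eq_square algebra_simps)
next
  case (h03 \<epsilon>)
  then show thesis
    by (intro that[of "- 2 * \<beta>" "- \<beta>"])
       (simp_all add: associator_def g35_nth axis_def power2_eq_square algebra_simps)
qed

lemma g35_list_associator_e3_e3_e1:
  assumes "p \<in> g35_list \<beta>"
  shows "associator p (e 3) (e 3) (e 1) \<noteq> 0"
proof
  assume "associator p (e 3) (e 3) (e 1) = 0"
  moreover obtain \<mu> a where
    "associator p (e 3) (e 3) (e 1) $ 1 = \<mu> * a - a\<^sup>2 + 1"
    "associator p (e 3) (e 3) (e 1) $ 2 = \<mu> - 2 * a"
    using assms by (rule g35_list_associator_e3_e3_e1_nth)
  ultimately have "\<mu> * a - a\<^sup>2 + 1 = 0" "\<mu> = 2 * a" by simp_all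
  then have "a\<^sup>2 + 1 = 0" by (simp add: power2_eq_square)
  then show False by (simp add: add_nonneg_eq_0_iff)
qed

lemma not_associative_g35_list: "p \<in> g35_list \<beta> \<Longrightarrow> \<not> associative_product p"
  using g35_list_associator_e3_e3_e1 unfolding associative_product_def by blast

lemma not_bisymmetric_g35_list: "p \<in> g35_list \<beta> \<Longrightarrow> \<not> bisymmetric_product p"
  using g35_list_associator_e3_e3_e1 g35_list_associator_e3_e1_e3
  by (metis bisymmetric_product_def)

lemma novikov_product_iff: "novikov_product p \<longleftrightarrow> (\<forall>X Y Z. p (p Z Y) X = p (p Z X) Y)"
  by (auto simp: novikov_product_def rmult_def fun_eq_iff)

lemma novikov_h01_iff: "novikov_product (h01 \<beta> l) \<longleftrightarrow> l = 0"
proof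
  assume "novikov_product (h01 \<beta> l)"
  \<comment> \<open>The left side is the second coordinate of l M(e 1), which is l; on the right, a
    plane vector multiplies from the left and gives 0.\<close>
  then have "h01 \<beta> l (h01 \<beta> l (e 3) (e 3)) (e 1) $ 2 = h01 \<beta> l (h01 \<beta> l (e 3) (e 1)) (e 3) $ 2"
    by (simp only: novikov_product_iff)
  then show "l = 0" by (simp add: h01_nth axis_def)
next
  assume "l = 0"
  \<comment> \<open>Now every product lies in the plane, whose left multiplications vanish.\<close>
  then show "novikov_product (h01 \<beta> l)"
    by (simp add: novikov_product_iff vec_eq_iff forall_3 h01_nth)
qed

text \<open>In complex notation, with m = l - \<beta> + i, Z = (z,s), Y = (y,t) and X = (x,u), the
  product (ZY)X is (l^2 t u z + l s m (u y + t x), l^2 s t u), symmetric in X and Y.\<close>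

lemma novikov_h02: "novikov_product (h02 \<beta> l)"
  by (simp add: novikov_product_iff vec_eq_iff forall_3 h02_nth algebra_simps)

lemma not_novikov_h03:
  assumes "\<epsilon> \<noteq> 0"
  shows "\<not> novikov_product (h03 \<beta> \<epsilon>)"
proof
  assume "novikov_product (h03 \<beta> \<epsilon>)"
  \<comment> \<open>Here \<open>e 2\<close> times \<open>e 2\<close> is \<epsilon>
    \<open>e 3\<close>, while \<open>e 2\<close> times \<open>e 1\<close> is 0.\<close>
  then have "h03 \<beta> \<epsilon> (h03 \<beta> \<epsilon> (e 2) (e 2)) (e 1) $ 2 = h03 \<beta> \<epsilon> (h03 \<beta> \<epsilon> (e 2) (e 1)) (e 2) $ 2"
    by (simp only: novikov_product_iff)
  with assms show False by (simp add: h03_nth axis_def)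
qed

lemma nilpotent_map_eigenvalue:
  fixes f :: "'a::real_vector \<Rightarrow> 'a"
  assumes "linear f" "nilpotent_map f" "f v = c *\<^sub>R v" "v \<noteq> 0"
  shows "c = 0"
proof -
  have pow: "(f ^^ n) v = c ^ n *\<^sub>R v" for n
    by (induction n) (simp_all add: assms linear_cmul mult.commute)
  obtain n where "f ^^ n = (\<lambda>_. 0)"
    using assms(2) by (auto simp: nilpotent_map_def)
  with pow[of n] assms(4) show ?thesis by auto
qed

lemma complete_product_eigenvalue:
  assumes "bilinear p" "complete_product p" "p v v = c *\<^sub>R v" "v \<noteq> 0"
  shows "c = 0"
  using assms nilpotent_map_eigenvalue[of "rmult p v" v c]
  by (simp add: bilinear_def complete_product_def rmult_def[abs_def])

text \<open>The exponent 3 is the dimension of \<open>real ^ 3\<close>, where every nilpotent linear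
  map has vanishing cube.\<close>

lemma complete_productI:
  assumes "\<And>X Y. p (p (p Y X) X) X = 0"
  shows "complete_product p"
  unfolding complete_product_def nilpotent_map_def
  by (intro allI exI[of _ 3]) (simp add: fun_eq_iff numeral_3_eq_3 rmult_def assms)

lemma complete_h01_iff: "complete_product (h01 \<beta> l) \<longleftrightarrow> l = 0"
proof
  assume "complete_product (h01 \<beta> l)"
  moreover have "h01 \<beta> l (e 3) (e 3) = l *\<^sub>R e 3" by (simp add: h01_def)
  ultimately show "l = 0"
    using complete_product_eigenvalue[of "h01 \<beta> l" "e 3" l]
    by (simp add: h01_def bilinear_bilinear_ext axis_eq_0_iff)
next
  assume "l = 0"
  then show "complete_product (h01 \<beta> l)"
    by (intro complete_productI) (simp add: vec_eq_iff forall_3 h01_nth)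
qed

text \<open>This excludes all listed \<open>h02\<close>, which have nonzero
  \<open>l\<close>.\<close>

lemma complete_h02_imp: "complete_product (h02 \<beta> l) \<Longrightarrow> l = 0"
  using complete_product_eigenvalue[of "h02 \<beta> l" "e 3" l]
  by (simp add: h02_def bilinear_bilinear_ext axis_eq_0_iff)

lemma complete_h03_iff: "complete_product (h03 \<beta> \<epsilon>) \<longleftrightarrow> \<beta> = 0"
proof
  assume "complete_product (h03 \<beta> \<epsilon>)"
  moreover have "h03 \<beta> \<epsilon> (e 3) (e 3) = (- 2 * \<beta>) *\<^sub>R e 3" by (simp add: h03_def)
  ultimately show "\<beta> = 0"
    using complete_product_eigenvalue[of "h03 \<beta> \<epsilon>" "e 3" "- 2 * \<beta>"]
    by (simp add: h03_def bilinear_bilinear_ext axis_eq_0_iff)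
next
  assume "\<beta> = 0"
  \<comment> \<open>With J the right-angle rotation \<open>M\<close> and X = (x,t), R_X maps (y,s)
    to (s J x, \<epsilon> <y,x>); its cube vanishes because J x is orthogonal to x.\<close>
  then show "complete_product (h03 \<beta> \<epsilon>)"
    by (intro complete_productI) (simp add: vec_eq_iff forall_3 h03_nth algebra_simps)
qed

theorem corollary8:
  fixes \<beta> :: real
  assumes "\<beta> \<ge> 0"
  shows "\<not> (\<exists>p \<in> g35_list \<beta>. associative_product p) \<and>
    {p \<in> g35_list \<beta>. novikov_product p} = {h01 \<beta> 0} \<union> {h02 \<beta> l | l. l \<noteq> 0} \<and>
    \<not> (\<exists>p \<in> g35_list \<beta>. bisymmetric_product p) \<and>
    {p \<in> g35_list \<beta>. complete_product p} =
      {h01 \<beta> 0} \<union> {h03 \<beta> \<epsilon> | \<epsilon>. \<epsilon> \<in> {1, - 1} \<and> \<beta> = 0}"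
proof (intro conjI)
  show "\<not> (\<exists>p \<in> g35_list \<beta>. associative_product p)"
    using not_associative_g35_list by blast
  show "\<not> (\<exists>p \<in> g35_list \<beta>. bisymmetric_product p)"
    using not_bisymmetric_g35_list by blast
  show "{p \<in> g35_list \<beta>. novikov_product p} = {h01 \<beta> 0} \<union> {h02 \<beta> l | l. l \<noteq> 0}"
    unfolding g35_list_def
    by (auto simp: novikov_h01_iff novikov_h02 not_novikov_h03)
  show "{p \<in> g35_list \<beta>. complete_product p} =
      {h01 \<beta> 0} \<union> {h03 \<beta> \<epsilon> | \<epsilon>. \<epsilon> \<in> {1, - 1} \<and> \<beta> = 0}"
    unfolding g35_list_def
    by (auto simp: complete_h01_iff complete_h03_iff dest: complete_h02_imp)
qed

end
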